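(* For any $\varepsilon>0$ there is a positive integer $p(\varepsilon)$ such that for all integers $p\ge p(\varepsilon)$ $$\mathcal{M}^{\mathrm{EE}}_p(\mathcal{S}_p)\le\frac{\left(\frac{2+\varepsilon}{W(1/e)}\right)^p}{(4+2\varepsilon)\pi\sqrt{p-1}}<\frac{(7.19+3.6\varepsilon)^p}{(4+2\varepsilon)\pi\sqrt{p-1}}.$$
   Context: Explicit Euler (EE) extrapolation of order $p\ge2$ on the test equation $U'=\lambda U$, with $z=\tau\lambda\in\mathbb{C}$ and internal perturbations: given $U_n$ and residuals $\tilde r_{m,j}\in\mathbb{C}$ ($1\le m\le p$, $1\le j\le m$), set $$\widetilde Y_{m,0}=U_n,\qquad \widetilde Y_{m,j}=\Big(1+\frac zm\Big)\widetilde Y_{m,j-1}+\tilde r_{m,j}\ (1\le j\le m),\qquad T_{m,1}=\widetilde Y_{m,m},$$ $$T_{j,k}=T_{j,k-1}+\frac{T_{j,k-1}-T_{j-1,k-1}}{\frac{j}{j-k+1}-1}\quad(2\le k\le j\le p),\qquad U_{n+1}=T_{p,p}.$$ Then $U_{n+1}=P(z)U_n+\sum_{m=1}^p\sum_{\ell=1}^mQ^{\mathrm{EE}}_{p,m,\ell}(z)\,\tilde r_{m,\ell}$, which defines the internal stability polynomials $Q^{\mathrm{EE}}_{p,m,\ell}$. For $\mathcal{S}\subset\mathbb{C}$, $$\mathcal{M}^{\mathrm{EE}}_p(\mathcal{S}):=\max_{1\le m\le p}\max_{1\le\ell\le m}\sup_{z\in\mathcal{S}}|Q^{\mathrm{EE}}_{p,m,\ell}(z)|.$$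 The absolute stability region of the method is $\mathcal{S}_p=\{z\in\mathbb{C}:|\sum_{k=0}^pz^k/k!|\le1\}$. $W$ is the Lambert function: for $x\ge-1/e$, $W(x)\ge-1$ is the unique number with $W(x)e^{W(x)}=x$. *)

theory Defs
  imports "HOL-Analysis.Analysis" "HOL-Computational_Algebra.Polynomial"
begin

primrec EE_Y :: "complex \<Rightarrow> complex \<Rightarrow> (nat \<Rightarrow> nat \<Rightarrow> complex) \<Rightarrow> nat \<Rightarrow> nat \<Rightarrow> complex" where
  "EE_Y z U r m 0 = U"
| "EE_Y z U r m (Suc j) = (1 + z / of_nat m) * EE_Y z U r m j + r m (Suc j)"

text \<open>Only the entries with \<open>1 \<le> k \<le> j\<close> are meaningful; these only refer to entries in the same range.\<close>
fun EE_T :: "complex \<Rightarrow> complex \<Rightarrow> (nat \<Rightarrow> nat \<Rightarrow> complex) \<Rightarrow> nat \<Rightarrow> nat \<Rightarrow> complex" where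
  "EE_T z U r j k =
     (if k \<le> 1 then EE_Y z U r j j
      else EE_T z U r j (k - 1) +
        (EE_T z U r j (k - 1) - EE_T z U r (j - 1) (k - 1)) /
        (of_nat j / (of_nat j - of_nat k + 1) - 1))"

declare EE_T.simps [simp del]

definition EE_step :: "nat \<Rightarrow> complex \<Rightarrow> complex \<Rightarrow> (nat \<Rightarrow> nat \<Rightarrow> complex) \<Rightarrow> complex" where
  "EE_step p z U r = EE_T z U r p p"

definition EE_expansion ::
  "nat \<Rightarrow> (complex \<Rightarrow> complex \<Rightarrow> (nat \<Rightarrow> nat \<Rightarrow> complex) \<Rightarrow> complex) \<Rightarrow>
   complex poly \<Rightarrow> (nat \<Rightarrow> nat \<Rightarrow> complex poly) \<Rightarrow> bool" where
  "EE_expansion p F P Q \<longleftrightarrow>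
     (\<forall>z U r. F z U r = poly P z * U + (\<Sum>m=1..p. \<Sum>l=1..m. poly (Q m l) z * r m l))"

text \<open>
  The polynomials are the coefficients of the expansion of one step in the residuals. That this
  determines them for \<open>1 \<le> l \<le> m \<le> p\<close> is shown in \<open>EE_expansion_EE_Q\<close> and
  \<open>EE_expansion_unique\<close> below.
\<close>
definition EE_Q :: "nat \<Rightarrow> nat \<Rightarrow> nat \<Rightarrow> complex poly" where
  "EE_Q p m l = (THE q. \<exists>P Q. EE_expansion p (EE_step p) P Q \<and> q = Q m l)"

text \<open>The supremum is taken in the extended reals, so that it is \<open>\<infinity>\<close> on sets where some
  polynomial is unbounded.\<close>
definition EE_M :: "nat \<Rightarrow> complex set \<Rightarrow> ereal" where
  "EE_M p S =
     Max ((\<lambda>m. Max ((\<lambda>l. SUP z\<in>S. ereal (cmod (poly (EE_Q p m l) z))) ` {1..m})) ` {1..p})"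

definition stability_region :: "nat \<Rightarrow> complex set" where
  "stability_region p = {z. cmod (\<Sum>k=0..p. z ^ k / fact k) \<le> 1}"

definition lambert_W :: "real \<Rightarrow> real" where
  "lambert_W x = (THE w. w \<ge> -1 \<and> w * exp w = x)"

lemma EE_expansion_unique:
  assumes "EE_expansion p F P Q" "EE_expansion p F P' Q'"
  shows "P = P'" and "1 \<le> l \<Longrightarrow> l \<le> m \<Longrightarrow> m \<le> p \<Longrightarrow> Q m l = Q' m l"
proof -
  have "poly P z = poly P' z" for z
    using assms[unfolded EE_expansion_def, rule_format, of z 1 "\<lambda>_ _. 0"] by simp
  then show "P = P'" by (simp add: poly_eq_poly_eq_iff[symmetric] fun_eq_iff)
next
  assume ml: "1 \<le> l" "l \<le> m" "m \<le> p"
  have sel: "(\<Sum>i=1..p. \<Sum>j=1..i. poly (R i j) z * (if i = m \<and> j = l then 1 else 0)) = poly (R m l) z"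
    for R :: "nat \<Rightarrow> nat \<Rightarrow> complex poly" and z
  proof -
    have "(\<Sum>i=1..p. \<Sum>j=1..i. poly (R i j) z * (if i = m \<and> j = l then 1 else 0))
        = (\<Sum>i=1..p. if i = m then poly (R m l) z else 0)"
    proof (rule sum.cong)
      fix i
      have "(\<Sum>j=1..i. poly (R i j) z * (if i = m \<and> j = l then 1 else 0))
          = (\<Sum>j=1..i. if j = l then (if i = m then poly (R m l) z else 0) else 0)"
        by (rule sum.cong) auto
      then show "(\<Sum>j=1..i. poly (R i j) z * (if i = m \<and> j = l then 1 else 0))
          = (if i = m then poly (R m l) z else 0)"
        using ml by auto
    qed simp
    then show ?thesis using ml by simp
  qed
  have "poly (Q m l) z = poly (Q' m l) z" for z
    using assms[unfolded EE_expansion_def, rule_format, of z 0 "\<lambda>i j. if i = m \<and> j = l then 1 else 0"]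
      sel[of Q z] sel[of Q' z] by simp
  then show "Q m l = Q' m l" by (simp add: poly_eq_poly_eq_iff[symmetric] fun_eq_iff)
qed

lemma EE_expansion_add:
  assumes "EE_expansion p F P Q" "EE_expansion p G P' Q'"
  shows "EE_expansion p (\<lambda>z U r. F z U r + G z U r) (P + P') (\<lambda>m l. Q m l + Q' m l)"
  using assms unfolding EE_expansion_def by (simp add: algebra_simps sum.distrib)

lemma EE_expansion_mult:
  assumes "EE_expansion p F P Q"
  shows "EE_expansion p (\<lambda>z U r. poly a z * F z U r) (a * P) (\<lambda>m l. a * Q m l)"
  using assms unfolding EE_expansion_def
  by (simp add: algebra_simps sum_distrib_left)

lemma EE_expansion_residual:
  assumes "1 \<le> j" "j \<le> m" "m \<le> p"
  shows "EE_expansion p (\<lambda>z U r. r m j) 0 (\<lambda>m' l'. if m' = m \<and> l' = j then 1 else 0)"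
  unfolding EE_expansion_def
proof (intro allI)
  fix z U :: complex and r :: "nat \<Rightarrow> nat \<Rightarrow> complex"
  have "(\<Sum>i=1..p. \<Sum>l=1..i. poly (if i = m \<and> l = j then 1 else 0) z * r i l)
      = (\<Sum>i=1..p. if i = m then r m j else 0)"
  proof (rule sum.cong)
    fix i
    have "(\<Sum>l=1..i. poly (if i = m \<and> l = j then 1 else 0) z * r i l)
        = (\<Sum>l=1..i. if l = j then (if i = m then r m j else 0) else 0)"
      by (rule sum.cong) auto
    then show "(\<Sum>l=1..i. poly (if i = m \<and> l = j then 1 else 0) z * r i l)
        = (if i = m then r m j else 0)"
      using assms by auto
  qed simp
  then show "r m j = poly 0 z * U +
      (\<Sum>i=1..p. \<Sum>l=1..i. poly (if i = m \<and> l = j then 1 else 0) z * r i l)"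
    using assms by simp
qed

lemma EE_expansion_Y:
  assumes "m \<le> p" "j \<le> m"
  shows "\<exists>P Q. EE_expansion p (\<lambda>z U r. EE_Y z U r m j) P Q"
  using assms(2)
proof (induction j)
  case 0
  have "EE_expansion p (\<lambda>z U r. EE_Y z U r m 0) 1 (\<lambda>_ _. 0)"
    by (simp add: EE_expansion_def)
  then show ?case by blast
next
  case (Suc j)
  then obtain P Q where "EE_expansion p (\<lambda>z U r. EE_Y z U r m j) P Q" by auto
  from EE_expansion_add[OF EE_expansion_mult[OF this, of "[:1, 1 / of_nat m:]"]
      EE_expansion_residual[of "Suc j" m p]] assms(1) Suc.prems
  show ?case by auto
qed

lemma EE_expansion_T:
  assumes "1 \<le> k" "k \<le> j" "j \<le> p"
  shows "\<exists>P Q. EE_expansion p (\<lambda>z U r. EE_T z U r j k) P Q"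
  using assms
proof (induction k arbitrary: j rule: nat_induct_at_least)
  case base
  then show ?case using EE_expansion_Y[of j p j] unfolding EE_T.simps[of _ _ _ j 1] by simp
next
  case (Suc k)
  define c :: complex where "c = 1 / (of_nat j / (of_nat j - of_nat (Suc k) + 1) - 1)"
  obtain P Q where 1: "EE_expansion p (\<lambda>z U r. EE_T z U r j k) P Q"
    using Suc.IH[of j] Suc.prems by fastforce
  obtain P' Q' where 2: "EE_expansion p (\<lambda>z U r. EE_T z U r (j - 1) k) P' Q'"
    using Suc.IH[of "j - 1"] Suc.prems Suc.hyps by fastforce
  have eq: "EE_T z U r j (Suc k) = poly [:1 + c:] z * EE_T z U r j k + poly [:- c:] z * EE_T z U r (j - 1) k"
    for z U r
  proof -
    have "EE_T z U r j (Suc k) = EE_T z U r j k + c * (EE_T z U r j k - EE_T z U r (j - 1) k)"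
      unfolding EE_T.simps[of z U r j "Suc k"] c_def using Suc.hyps by simp
    then show ?thesis by (simp add: algebra_simps)
  qed
  show ?case unfolding eq
    using EE_expansion_add[OF EE_expansion_mult[OF 1] EE_expansion_mult[OF 2]] by blast
qed

lemma EE_expansion_EE_Q:
  assumes "1 \<le> p"
  shows "\<exists>P. EE_expansion p (EE_step p) P (EE_Q p)"
proof -
  obtain P Q where PQ: "EE_expansion p (EE_step p) P Q"
    using EE_expansion_T[of p p p] assms by (auto simp: EE_step_def[abs_def])
  have eq: "EE_Q p m l = Q m l" if "1 \<le> l" "l \<le> m" "m \<le> p" for m l
    unfolding EE_Q_def
  proof (rule the_equality)
    show "\<exists>P Q'. EE_expansion p (EE_step p) P Q' \<and> Q m l = Q' m l"
      using PQ by blast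
  next
    fix q assume "\<exists>P Q'. EE_expansion p (EE_step p) P Q' \<and> q = Q' m l"
    then obtain P' Q' where "EE_expansion p (EE_step p) P' Q'" "q = Q' m l" by blast
    then show "q = Q m l" using EE_expansion_unique(2)[OF PQ _ that] by metis
  qed
  have "(\<Sum>m=1..p. \<Sum>l=1..m. poly (EE_Q p m l) z * r m l)
      = (\<Sum>m=1..p. \<Sum>l=1..m. poly (Q m l) z * r m l)" for z r
    by (intro sum.cong refl) (simp add: eq)
  then have "EE_expansion p (EE_step p) P (EE_Q p)"
    using PQ by (simp only: EE_expansion_def simp_thms)
  then show ?thesis by blast
qed

end

theory Submission
  imports Defs
begin

text \<open>
  Aitken-Neville extrapolation with the step numbers \<open>1, \<dots>, p\<close> is an \<open>(p - 1)\<close>-th forward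
  difference of \<open>m \<mapsto> m^(p-1) T_{m,1}\<close>, so \<open>T_{m,1}\<close> enters the new value with a weight of modulus
  \<open>(p choose m) m^p / p!\<close>, and the internal stability polynomial is this weight times
  \<open>(1 + z/m)^(m-l)\<close> (\<open>EE_Q_eq\<close>). It remains to bound that quantity on the stability region.

  An Enestrom-Kakeya argument shows \<open>|z| \<le> p + 2\<close> on the region
  (\<open>stability_region_norm_le\<close>). Then every factor of the product is replaced by something exponential
  in \<open>m\<close> and \<open>p\<close>: \<open>(1 + (p+2)/m)^m \<le> e (\<surd>e)^p (2/\<surd>e)^m\<close> by \<open>1 + x \<le> e^x\<close>, and
  \<open>m^p / p! \<le> e^(xm) / x^p\<close> for every \<open>x > 0\<close>. What is left is a single term of a binomial expansion,
  so the polynomials are at most \<open>e ((\<surd>e + 2 e^x) / x)^p\<close> (\<open>EE_M_le\<close>).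

  With \<open>w = W(1/e)\<close>, take \<open>x = 1 + w\<close>. This minimises \<open>(1 + e^x) / x\<close>, whose \<open>p\<close>-th power bounds
  the modulus of the weights alone, and it gives \<open>e^x = 1/w\<close>. The base of the power becomes \<open>(\<surd>e + 2/w) / (1 + w)\<close>, which is strictly less than
  \<open>2/w\<close> because \<open>\<surd>e < 2\<close>. This exponential gain over \<open>(2/w)^p\<close> absorbs the factor
  \<open>4 \<pi> \<surd>(p-1)\<close>; increasing \<open>\<epsilon>\<close> only enlarges the right-hand side. The second inequality of
  the theorem amounts to \<open>W(1/e) > 1/3.595\<close>.
\<close>

section \<open>The internal stability polynomials\<close>

lemma EE_Y_eq:
  "EE_Y z U r m j = (1 + z / of_nat m) ^ j * U + (\<Sum>l=1..j. (1 + z / of_nat m) ^ (j - l) * r m l)"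
proof (induction j)
  case (Suc j)
  have "(\<Sum>l=1..j. (1 + z / of_nat m) ^ (Suc j - l) * r m l)
      = (1 + z / of_nat m) * (\<Sum>l=1..j. (1 + z / of_nat m) ^ (j - l) * r m l)"
    by (auto simp: sum_distrib_left Suc_diff_le intro!: sum.cong)
  then show ?case using Suc by (simp add: algebra_simps)
qed simp

text \<open>
  The right-hand side is \<open>1/n!\<close> times the \<open>n\<close>-th forward difference of \<open>x \<mapsto> x^n T_{x,1}\<close> at
  \<open>a + 1\<close>. The recursion of the tableau combines two such differences with the factors \<open>a + n + 2\<close>
  and \<open>a + 1\<close>; with Pascal's rule and the absorption identity, the coefficient of the \<open>i\<close>-th
  value becomes \<open>(a + 1 + i) ((n+1) choose i)\<close>.
\<close>
lemma EE_T_eq_binomial_sum: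
  "EE_T z U r (a + n + 1) (n + 1) =
     (\<Sum>i\<le>n. (-1) ^ (n + i) * of_nat (n choose i) * of_nat (a + 1 + i) ^ n * EE_Y z U r (a + 1 + i) (a + 1 + i))
       / fact n"
proof (induction n arbitrary: a)
  case 0
  then show ?case by (simp add: EE_T.simps)
next
  case (Suc n)
  define g :: "nat \<Rightarrow> complex" where
    "g i = of_nat (a + 1 + i) ^ n * EE_Y z U r (a + 1 + i) (a + 1 + i)" for i
  define S1 where "S1 = (\<Sum>i\<le>n. (-1) ^ (n + i) * of_nat (n choose i) * g (Suc i))"
  define S0 where "S0 = (\<Sum>i\<le>n. (-1) ^ (n + i) * of_nat (n choose i) * g i)"
  have T1: "EE_T z U r (a + Suc n + 1) (Suc n) = S1 / fact n"
    using Suc.IH[of "Suc a"] by (simp add: S1_def g_def mult.assoc)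
  have T0: "EE_T z U r (a + Suc n) (Suc n) = S0 / fact n"
    using Suc.IH[of a] by (simp add: S0_def g_def mult.assoc)
  have factor: "1 / (of_nat (a + Suc n + 1) / (of_nat (a + Suc n + 1) - of_nat (Suc n + 1) + 1) - 1)
      = (of_nat (a + 1) / of_nat (n + 1) :: complex)"
  proof -
    have d: "of_nat (a + Suc n + 1) - of_nat (Suc n + 1) + 1 = (of_nat (a + 1) :: complex)"
      by simp
    have nz: "(of_nat (a + 1) :: complex) \<noteq> 0" "(of_nat (n + 1) :: complex) \<noteq> 0"
      unfolding of_nat_eq_0_iff by simp_all
    have "of_nat (a + Suc n + 1) / of_nat (a + 1) - 1 = (of_nat (n + 1) / of_nat (a + 1) :: complex)"
      using nz by (simp add: field_simps)
    then show ?thesis unfolding d by simp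
  qed
  have rec: "EE_T z U r (a + Suc n + 1) (Suc n + 1)
      = S1 / fact n + (S1 / fact n - S0 / fact n) * (of_nat (a + 1) / of_nat (n + 1))"
    unfolding EE_T.simps[of z U r "a + Suc n + 1" "Suc n + 1"] factor[symmetric]
    using T0 T1 by simp
  have nz: "(of_nat (n + 1) :: complex) \<noteq> 0"
    unfolding of_nat_eq_0_iff by simp
  have combined: "EE_T z U r (a + Suc n + 1) (Suc n + 1)
      = (of_nat (a + n + 2) * S1 - of_nat (a + 1) * S0) / fact (Suc n)"
    unfolding rec using nz by (simp add: divide_simps) (simp add: algebra_simps)
  have S1': "S1 = (\<Sum>i\<in>{..Suc n} - {0}. (-1) ^ (Suc n + i) * of_nat (n choose (i - 1)) * g i)"
  proof -
    have "{..Suc n} - {0} = Suc ` {..n}"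
      by (auto simp: image_iff) (metis Suc_pred atMost_iff not_gr_zero Suc_le_mono)
    then show ?thesis unfolding S1_def
      by (simp add: sum.reindex)
  qed
  \<comment> \<open>Setting \<open>i = 0\<close> apart, where \<open>i - 1\<close> truncates, both sums can be compared term by term.\<close>
  have S1'': "S1 = (\<Sum>i\<le>Suc n. (-1) ^ (Suc n + i) * of_nat (if i = 0 then 0 else n choose (i - 1)) * g i)"
    unfolding S1' by (rule sum.mono_neutral_cong_left) auto
  have S0': "S0 = - (\<Sum>i\<le>Suc n. (-1) ^ (Suc n + i) * of_nat (n choose i) * g i)"
    by (simp add: S0_def sum_negf[symmetric] binomial_eq_0)
  have absorb: "(a + n + 2) * (if i = 0 then 0 else n choose (i - 1)) + (a + 1) * (n choose i)
      = (a + 1 + i) * (Suc n choose i)" for i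
  proof (cases i)
    case (Suc k)
    have "(n + 1) * (n choose k) = (k + 1) * (Suc n choose Suc k)"
      using Suc_times_binomial[of k n] by simp
    moreover have "(a + n + 2) * (n choose k) = (a + 1) * (n choose k) + (n + 1) * (n choose k)"
      by (simp add: algebra_simps)
    ultimately show ?thesis using Suc by (simp add: algebra_simps)
  qed simp
  have "of_nat (a + n + 2) * S1 - of_nat (a + 1) * S0
      = (\<Sum>i\<le>Suc n. (-1) ^ (Suc n + i) *
          of_nat ((a + n + 2) * (if i = 0 then 0 else n choose (i - 1)) + (a + 1) * (n choose i)) * g i)"
    unfolding S1'' S0' sum_distrib_left mult_minus_right diff_minus_eq_add sum.distrib[symmetric]
    by (rule sum.cong) (simp_all only: of_nat_add of_nat_mult, simp add: algebra_simps)
  also have "\<dots> = (\<Sum>i\<le>Suc n. (-1) ^ (Suc n + i) * of_nat (Suc n choose i) * of_nat (a + 1 + i) ^ Suc n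
      * EE_Y z U r (a + 1 + i) (a + 1 + i))"
    unfolding absorb by (rule sum.cong) (simp_all only: g_def of_nat_mult power_Suc mult_ac)
  finally show ?case using combined by simp
qed

definition extrapolation_weight :: "nat \<Rightarrow> nat \<Rightarrow> complex" where
  "extrapolation_weight p m = (-1) ^ (p + m) * of_nat (p choose m) * of_nat m ^ p / fact p"

lemma EE_step_eq_weighted_sum:
  assumes "1 \<le> p"
  shows "EE_step p z U r = (\<Sum>m=1..p. extrapolation_weight p m * EE_Y z U r m m)"
proof -
  obtain n where n: "p = Suc n" using assms by (cases p) auto
  have weight: "(-1) ^ (n + i) * of_nat (n choose i) * of_nat (Suc i) ^ n / fact n
      = extrapolation_weight p (Suc i)" for i
  proof -
    have absorb: "(of_nat (Suc i) * of_nat (Suc n choose Suc i) :: complex) = of_nat (Suc n) * of_nat (n choose i)"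
      unfolding of_nat_mult[symmetric] Suc_times_binomial ..
    have "extrapolation_weight p (Suc i)
        = (-1) ^ (n + i) * (of_nat (Suc i) * of_nat (Suc n choose Suc i)) * of_nat (Suc i) ^ n / fact (Suc n)"
      unfolding extrapolation_weight_def n by (simp add: mult_ac del: of_nat_Suc binomial_Suc_Suc)
    also have "\<dots> = (-1) ^ (n + i) * (of_nat (Suc n) * of_nat (n choose i)) * of_nat (Suc i) ^ n / fact (Suc n)"
      unfolding absorb ..
    also have "\<dots> = (-1) ^ (n + i) * of_nat (n choose i) * of_nat (Suc i) ^ n / fact n"
      unfolding fact_Suc by (simp add: of_nat_neq_0 del: of_nat_Suc binomial_Suc_Suc)
    finally show ?thesis ..
  qed
  have "EE_step p z U r = (\<Sum>i\<le>n. extrapolation_weight p (Suc i) * EE_Y z U r (Suc i) (Suc i))"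
    using EE_T_eq_binomial_sum[of z U r 0 n]
    by (simp add: EE_step_def n sum_divide_distrib weight[symmetric, unfolded n] del: of_nat_Suc)
  also have "\<dots> = (\<Sum>m=1..p. extrapolation_weight p m * EE_Y z U r m m)"
    unfolding n by (simp add: sum.shift_bounds_cl_Suc_ivl atMost_atLeast0 del: sum.cl_ivl_Suc)
  finally show ?thesis .
qed

lemma EE_Q_eq:
  assumes "1 \<le> l" "l \<le> m" "m \<le> p"
  shows "poly (EE_Q p m l) z = extrapolation_weight p m * (1 + z / of_nat m) ^ (m - l)"
proof -
  define P where "P = (\<Sum>m=1..p. smult (extrapolation_weight p m) ([:1, 1 / of_nat m:] ^ m))"
  define Q where "Q m l = smult (extrapolation_weight p m) ([:1, 1 / of_nat m:] ^ (m - l))" for m l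
  have "EE_expansion p (EE_step p) P Q"
    unfolding EE_expansion_def
    using assms
    by (simp add: EE_step_eq_weighted_sum EE_Y_eq P_def Q_def poly_sum
        distrib_left sum.distrib sum_distrib_left sum_distrib_right mult.assoc)
  moreover obtain P' where "EE_expansion p (EE_step p) P' (EE_Q p)"
    using EE_expansion_EE_Q[of p] assms by auto
  ultimately have "EE_Q p m l = Q m l"
    using EE_expansion_unique(2) assms by blast
  then show ?thesis by (simp add: Q_def)
qed

section \<open>Size of the stability region\<close>

lemma linear_times_exp_partial_sum:
  fixes z c :: "'a :: {field_char_0}"
  shows "(z - c) * (\<Sum>k\<le>n. z ^ k / fact k) = z ^ Suc n / fact n - (\<Sum>k\<le>n. (c - of_nat k) * z ^ k / fact k)"
proof (induction n)
  case (Suc n)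
  have nz: "(1 + of_nat n :: 'a) \<noteq> 0"
    by (metis of_nat_Suc of_nat_eq_0_iff nat.distinct(1))
  have "z ^ Suc n / fact n = of_nat (Suc n) * z ^ Suc n / fact (Suc n)"
    using nz by (simp add: divide_simps)
  then show ?case using Suc
    by (simp only: sum.atMost_Suc distrib_left)
       (simp add: algebra_simps diff_divide_distrib add_divide_distrib)
qed simp

text \<open>
  As in the Enestrom-Kakeya theorem, multiplying the partial sum \<open>s\<close> by \<open>z - p\<close> leaves one
  positive coefficient, the leading one. Hence \<open>|z - p| |s(z)|\<close> is at least \<open>(|z| - p) s(|z|)\<close>, and
  \<open>s(|z|) \<ge> 1 + |z|\<close> exceeds \<open>(|z| + p) / (|z| - p)\<close> as soon as \<open>|z| > p + 2\<close>.
\<close>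
lemma stability_region_norm_le:
  assumes "z \<in> stability_region p" "1 \<le> p"
  shows "cmod z \<le> real p + 2"
proof (rule ccontr)
  define r where "r = cmod z"
  define s where "s = (\<Sum>k\<le>p. r ^ k / fact k)"
  assume "\<not> ?thesis"
  then have r: "r > real p + 2" by (simp add: r_def)
  have "1 + r = (\<Sum>k\<in>{0,1}. r ^ k / fact k)" by simp
  also have "\<dots> \<le> s"
    unfolding s_def using assms(2) by (intro sum_mono2) (auto simp: r_def)
  finally have s: "1 + r \<le> s" .
  have "(r - real p) * s = r ^ Suc p / fact p - (\<Sum>k\<le>p. (real p - real k) * r ^ k / fact k)"
    unfolding s_def by (rule linear_times_exp_partial_sum)
  also have "\<dots> \<le> cmod (z ^ Suc p / fact p) - cmod (\<Sum>k\<le>p. (of_nat p - of_nat k) * z ^ k / fact k)"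
  proof -
    have "cmod ((of_nat p - of_nat k) * z ^ k / fact k) = (real p - real k) * r ^ k / fact k"
      if "k \<le> p" for k
      using that by (simp add: r_def norm_mult norm_divide norm_power flip: of_nat_diff)
    then have "cmod (\<Sum>k\<le>p. (of_nat p - of_nat k) * z ^ k / fact k)
        \<le> (\<Sum>k\<le>p. (real p - real k) * r ^ k / fact k)"
      by (intro sum_norm_le) simp
    moreover have "cmod (z ^ Suc p / fact p) = r ^ Suc p / fact p"
      by (simp add: r_def norm_mult norm_divide norm_power)
    ultimately show ?thesis by simp
  qed
  also have "\<dots> \<le> cmod ((z - of_nat p) * (\<Sum>k\<le>p. z ^ k / fact k))"
    unfolding linear_times_exp_partial_sum by (rule norm_triangle_ineq2)
  also have "\<dots> \<le> cmod (z - of_nat p) * 1"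
    using assms(1) unfolding norm_mult stability_region_def
    by (intro mult_left_mono) (simp_all add: atMost_atLeast0)
  also have "\<dots> \<le> r + real p"
    using norm_triangle_ineq4[of z "of_nat p"] by (simp add: r_def)
  finally have upper: "(r - real p) * s \<le> r + real p" .
  have "2 * (1 + r) \<le> (r - real p) * s"
    using r s by (intro mult_mono) auto
  then have "2 * (1 + r) \<le> r + real p"
    using upper by (rule order.trans)
  then show False using r by simp
qed

section \<open>An exponential bound for the polynomials\<close>

lemma power_div_fact_le_exp:
  fixes x :: real
  assumes "0 \<le> x"
  shows "x ^ n / fact n \<le> exp x"
proof -
  have "(\<Sum>k\<in>{n}. inverse (fact k) *\<^sub>R x ^ k) \<le> (\<Sum>k. inverse (fact k) *\<^sub>R x ^ k)"
    by (rule sum_le_suminf[OF summable_exp_generic]) (use assms in auto)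
  then show ?thesis by (simp add: exp_def field_simps)
qed

lemma binomial_times_power_le:
  fixes y :: real
  assumes "0 \<le> y" "m \<le> p"
  shows "real (p choose m) * y ^ m \<le> (1 + y) ^ p"
proof -
  have "(\<Sum>k\<in>{m}. real (p choose k) * y ^ k) \<le> (\<Sum>k\<le>p. real (p choose k) * y ^ k)"
    by (rule sum_mono2) (use assms in auto)
  also have "\<dots> = (1 + y) ^ p"
    using binomial_ring[of y 1 p] by (simp add: add.commute)
  finally show ?thesis by simp
qed

text \<open>
  Half of \<open>1 + t\<close> is \<open>1 + (t - 1)/2 \<le> e^((t-1)/2)\<close>; this is sharp at \<open>t = 1\<close>, that is for
  \<open>m\<close> close to \<open>p\<close>, where the left-hand side is largest among \<open>m \<le> p\<close> (about \<open>e 2^p\<close>). The resulting bound is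
  geometric in \<open>m\<close>, so it can be absorbed into a binomial sum.
\<close>
lemma one_plus_power_le:
  fixes m p :: nat
  assumes "1 \<le> m"
  shows "(1 + (real p + 2) / real m) ^ m \<le> exp 1 * exp (1/2) ^ p * (2 / exp (1/2)) ^ m"
proof -
  define t where "t = (real p + 2) / real m"
  have "1 + t \<le> 2 * exp ((t - 1) / 2)"
    using exp_ge_add_one_self[of "(t - 1) / 2"] by (simp add: field_simps)
  moreover have "0 \<le> t" by (simp add: t_def)
  ultimately have "(1 + t) ^ m \<le> (2 * exp ((t - 1) / 2)) ^ m"
    by (intro power_mono) auto
  also have "\<dots> = 2 ^ m * exp (real m * ((t - 1) / 2))"
    by (simp add: power_mult_distrib flip: exp_of_nat_mult)
  also have "real m * ((t - 1) / 2) = 1 + real p * (1/2) - real m * (1/2)"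
    using assms by (simp add: t_def field_simps)
  also have "2 ^ m * exp (1 + real p * (1/2) - real m * (1/2))
      = exp 1 * exp (1/2) ^ p * (2 / exp (1/2)) ^ m"
    unfolding exp_diff exp_add exp_of_nat_mult by (simp add: power_divide)
  finally show ?thesis unfolding t_def .
qed

text \<open>
  The parameter \<open>x\<close> comes from \<open>m^p / p! \<le> e^(xm) / x^p\<close>. All dependence on \<open>m\<close> is then in
  \<open>(p choose m) (2 e^x / \<surd>e)^m\<close>, which is one term of the binomial expansion of
  \<open>(1 + 2 e^x / \<surd>e)^p\<close>.
\<close>
lemma norm_EE_Q_le:
  assumes "1 \<le> l" "l \<le> m" "m \<le> p" "z \<in> stability_region p" "0 < x"
  shows "cmod (poly (EE_Q p m l) z) \<le> exp 1 * ((exp (1/2) + 2 * exp x) / x) ^ p"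
proof -
  have m: "1 \<le> m" using assms by simp
  define h :: real where "h = exp (1/2)"
  have h: "h > 0" by (simp add: h_def)
  have "cmod (1 + z / of_nat m) \<le> 1 + cmod z / real m"
    using norm_triangle_ineq[of 1 "z / of_nat m"] by (simp add: norm_divide)
  also have "\<dots> \<le> 1 + (real p + 2) / real m"
    using stability_region_norm_le[OF assms(4)] assms(1-3) by (simp add: divide_right_mono)
  finally have "cmod (1 + z / of_nat m) ^ (m - l) \<le> (1 + (real p + 2) / real m) ^ (m - l)"
    by (intro power_mono) auto
  also have "\<dots> \<le> (1 + (real p + 2) / real m) ^ m"
    by (intro power_increasing) auto
  also have "\<dots> \<le> exp 1 * h ^ p * (2 / h) ^ m"
    unfolding h_def by (rule one_plus_power_le[OF m])
  finally have stage: "cmod (1 + z / of_nat m) ^ (m - l) \<le> exp 1 * h ^ p * (2 / h) ^ m" .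
  have "(x * real m) ^ p / fact p \<le> exp (x * real m)"
    using assms(5) by (intro power_div_fact_le_exp) auto
  then have moment: "real m ^ p / fact p \<le> exp x ^ m / x ^ p"
    using assms(5) exp_of_nat_mult[of m x] by (simp add: field_simps power_mult_distrib)
  have "cmod (poly (EE_Q p m l) z)
      = real (p choose m) * (real m ^ p / fact p) * cmod (1 + z / of_nat m) ^ (m - l)"
    unfolding EE_Q_eq[OF assms(1-3)] extrapolation_weight_def
    by (simp add: norm_mult norm_divide norm_power)
  also have "\<dots> \<le> real (p choose m) * (exp x ^ m / x ^ p) * (exp 1 * h ^ p * (2 / h) ^ m)"
    using stage moment assms(5) by (intro mult_mono mult_nonneg_nonneg) auto
  also have "\<dots> = exp 1 * (h / x) ^ p * (real (p choose m) * (2 * exp x / h) ^ m)"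
    by (simp add: power_divide power_mult_distrib)
  also have "\<dots> \<le> exp 1 * (h / x) ^ p * (1 + 2 * exp x / h) ^ p"
    using assms(3,5) h by (intro mult_left_mono binomial_times_power_le) auto
  also have "\<dots> = exp 1 * ((h / x) * (1 + 2 * exp x / h)) ^ p"
    by (simp only: power_mult_distrib mult.assoc)
  also have "(h / x) * (1 + 2 * exp x / h) = (h + 2 * exp x) / x"
    using h assms(5) by (simp add: field_simps)
  finally show ?thesis unfolding h_def .
qed

lemma EE_M_le:
  assumes "1 \<le> p" "0 < x"
  shows "EE_M p (stability_region p) \<le> ereal (exp 1 * ((exp (1/2) + 2 * exp x) / x) ^ p)"
  using assms by (auto simp: EE_M_def intro!: SUP_least norm_EE_Q_le)

section \<open>The Lambert function at 1/e\<close>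

lemma mult_exp_strict_mono:
  fixes v w :: real
  assumes "0 \<le> v" "v < w"
  shows "v * exp v < w * exp w"
  using assms by (intro mult_strict_mono) auto

lemma lambert_W_mult_exp:
  assumes "0 \<le> w"
  shows "lambert_W (w * exp w) = w"
  unfolding lambert_W_def
proof (rule the_equality)
  fix v assume v: "- 1 \<le> v \<and> v * exp v = w * exp w"
  then have "0 \<le> v * exp v" using assms by simp
  then have "0 \<le> v" by (simp add: zero_le_mult_iff)
  then show "v = w"
    using v assms mult_exp_strict_mono[of v w] mult_exp_strict_mono[of w v] by fastforce
qed (use assms in auto)

text \<open>
  Since \<open>e < 2.72\<close>, this gives \<open>c e^c < 1/e\<close> for \<open>c = 1/3.595\<close>, hence \<open>c < W(1/e)\<close>. The relative
  margin is below one part in a thousand, which calls for a Taylor polynomial of degree three.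
\<close>
lemma exp_inverse_3595_less: "exp (1 / 3.595 :: real) < 3.595 / 2.72"
proof -
  define c :: real where "c = 1 / 3.595"
  obtain t where t: "\<bar>t\<bar> \<le> \<bar>c\<bar>" "exp c = (\<Sum>k<4. c ^ k / fact k) + exp t / fact 4 * c ^ 4"
    using Maclaurin_exp_le[of c 4] by blast
  have "t \<le> 1/2" using t(1) by (auto simp: c_def)
  then have "exp t \<le> exp (1/2)" by simp
  also have "\<dots> \<le> 2" using exp_bound_half[of "1/2 :: real"] by simp
  finally have "exp t \<le> 2" .
  then have "exp t / fact 4 * c ^ 4 \<le> 2 / fact 4 * c ^ 4"
    by (intro mult_right_mono divide_right_mono) (auto simp: c_def)
  then have "exp c \<le> (\<Sum>k<4. c ^ k / fact k) + 2 / fact 4 * c ^ 4"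
    using t(2) by simp
  also have "\<dots> < 3.595 / 2.72"
    by (simp add: c_def eval_nat_numeral fact_numeral)
  finally show ?thesis by (simp only: c_def)
qed

lemma lambert_W_inverse_e:
  defines "w \<equiv> lambert_W (1 / exp 1)"
  shows "exp (1 + w) = 1 / w" and "1 / 3.595 < w"
proof -
  define c :: real where "c = 1 / 3.595"
  have c: "c * exp c < 1 / exp 1"
  proof -
    have "c * exp c < 1 / 2.72"
      using exp_inverse_3595_less unfolding c_def by simp
    also have "\<dots> < 1 / exp 1"
      using e_less_272 by (simp add: field_simps)
    finally show ?thesis .
  qed
  have "1 / exp 1 = exp (- 1 :: real)" by (simp add: exp_minus field_simps)
  also have "\<dots> \<le> 1 * exp 1" by simp
  finally have "1 / exp 1 \<le> (1::real) * exp 1" .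
  moreover have "continuous_on {c..1} (\<lambda>v. v * exp v)"
    by (intro continuous_intros)
  moreover have "c \<le> 1" by (simp add: c_def)
  ultimately obtain v where v: "c \<le> v" "v * exp v = 1 / exp 1"
    using IVT'[of "\<lambda>v. v * exp v" c "1 / exp 1" 1] less_imp_le[OF c] by blast
  have "w = v"
    using lambert_W_mult_exp[of v] v by (simp add: w_def c_def)
  moreover have "v > 0" using v(1) by (simp add: c_def)
  ultimately show "exp (1 + w) = 1 / w"
    using v(2) by (simp add: exp_add field_simps)
  have "c \<noteq> v" using c v(2) by auto
  then show "1 / 3.595 < w"
    using v(1) \<open>w = v\<close> by (simp add: c_def)
qed

section \<open>The asymptotic bound\<close>

lemma sqrt_times_geometric_eventually_le_1:
  fixes q C :: real
  assumes "0 < q" "q < 1" "0 \<le> C"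
  shows "\<exists>N. \<forall>n\<ge>N. C * sqrt (real n - 1) * q ^ n \<le> 1"
proof -
  have "(\<lambda>n. C * (real n * q ^ n)) \<longlonglongrightarrow> C * 0"
    using powser_times_n_limit_0[of q] assms by (intro tendsto_mult_left) simp
  then have "\<forall>\<^sub>F n in sequentially. C * (real n * q ^ n) < 1"
    by (rule order_tendstoD) simp
  then obtain N where N: "\<And>n. n \<ge> N \<Longrightarrow> C * (real n * q ^ n) < 1"
    by (auto simp: eventually_sequentially)
  have "C * sqrt (real n - 1) * q ^ n \<le> 1" if "n \<ge> N" for n
  proof -
    have "real n - 1 \<le> (real n)\<^sup>2"
      by (cases n) (auto simp: power2_eq_square algebra_simps)
    then have "sqrt (real n - 1) \<le> real n"
      by (intro real_le_lsqrt) auto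
    then have "C * sqrt (real n - 1) * q ^ n \<le> C * real n * q ^ n"
      using assms by (intro mult_right_mono mult_left_mono) auto
    with N[OF that] show ?thesis by (simp add: mult.assoc)
  qed
  then show ?thesis by blast
qed

theorem theorem4p13:
  fixes \<epsilon> :: real
  assumes "\<epsilon> > 0"
  shows "\<exists>N::nat. N > 0 \<and> (\<forall>p::nat. p \<ge> 2 \<and> p \<ge> N \<longrightarrow>
    EE_M p (stability_region p)
      \<le> ereal (((2 + \<epsilon>) / lambert_W (1 / exp 1)) ^ p / ((4 + 2 * \<epsilon>) * pi * sqrt (real p - 1))) \<and>
    ((2 + \<epsilon>) / lambert_W (1 / exp 1)) ^ p / ((4 + 2 * \<epsilon>) * pi * sqrt (real p - 1))
      < (7.19 + 3.6 * \<epsilon>) ^ p / ((4 + 2 * \<epsilon>) * pi * sqrt (real p - 1)))"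
proof -
  define w where "w = lambert_W (1 / exp 1)"
  have exp_w: "exp (1 + w) = 1 / w" and w_gt: "1 / 3.595 < w"
    using lambert_W_inverse_e unfolding w_def by blast+
  have w: "w > 0" using w_gt by (simp add: field_simps)
  \<comment> \<open>\<open>q\<close> compares the base obtained for \<open>x = 1 + w\<close> with \<open>2/w\<close>.\<close>
  define q where "q = (exp (1/2) + 2 * exp (1 + w)) / (1 + w) / (2 / w)"
  have q0: "q > 0" using w by (simp add: q_def add_pos_pos)
  have "exp (1/2 :: real) < 2"
  proof -
    have "exp (1/2 :: real) ^ 2 = exp 1" by (simp flip: exp_of_nat_mult)
    also have "\<dots> < 2 ^ 2" using e_less_272 by simp
    finally show ?thesis by (rule power_less_imp_less_base) simp
  qed
  then have q1: "q < 1"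
    using w by (simp add: q_def exp_w divide_simps)
  obtain N where N: "\<And>n. n \<ge> N \<Longrightarrow> (exp 1 * 4 * pi) * sqrt (real n - 1) * q ^ n \<le> 1"
    using sqrt_times_geometric_eventually_le_1[OF q0 q1, of "exp 1 * 4 * pi"] by auto
  have "EE_M p (stability_region p)
      \<le> ereal (((2 + \<epsilon>) / w) ^ p / ((4 + 2 * \<epsilon>) * pi * sqrt (real p - 1))) \<and>
    ((2 + \<epsilon>) / w) ^ p / ((4 + 2 * \<epsilon>) * pi * sqrt (real p - 1))
      < (7.19 + 3.6 * \<epsilon>) ^ p / ((4 + 2 * \<epsilon>) * pi * sqrt (real p - 1))"
    if p: "p \<ge> 2" "p \<ge> N" for p
  proof
    define D where "D = pi * sqrt (real p - 1)"
    have D: "D > 0" using p(1) by (simp add: D_def)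
    have "2 / w \<noteq> 0" using w by simp
    then have "q * (2 / w) = (exp (1/2) + 2 * exp (1 + w)) / (1 + w)"
      by (rule iffD1[OF nonzero_eq_divide_eq q_def])
    then have "exp 1 * ((exp (1/2) + 2 * exp (1 + w)) / (1 + w)) ^ p = exp 1 * q ^ p * (2 / w) ^ p"
      by (metis power_mult_distrib mult.assoc)
    also have "\<dots> \<le> 1 / (4 * D) * (2 / w) ^ p"
      using N[OF p(2)] D w by (intro mult_right_mono) (simp_all add: D_def field_simps)
    also have "\<dots> \<le> 1 / (4 * D) * ((2 / w) ^ p * (1 + \<epsilon> / 2) ^ (p - 1))"
    proof -
      have "1 \<le> (1 + \<epsilon> / 2) ^ (p - 1)" using assms by (intro one_le_power) simp
      then have "(2 / w) ^ p * 1 \<le> (2 / w) ^ p * (1 + \<epsilon> / 2) ^ (p - 1)"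
        using w by (intro mult_left_mono) auto
      then show ?thesis using D by (intro mult_left_mono) auto
    qed
    also have "\<dots> = ((2 + \<epsilon>) / w) ^ p / ((4 + 2 * \<epsilon>) * D)"
    proof -
      have "(2 + \<epsilon>) / w = (2 / w) * (1 + \<epsilon> / 2)"
        using w by (simp add: field_simps)
      then have "((2 + \<epsilon>) / w) ^ p = (2 / w) ^ p * (1 + \<epsilon> / 2) ^ p"
        by (simp only: power_mult_distrib)
      also have "(1 + \<epsilon> / 2) ^ p = (1 + \<epsilon> / 2) ^ (p - 1) * (1 + \<epsilon> / 2)"
        using p(1) by (cases p) auto
      finally have "((2 + \<epsilon>) / w) ^ p = (2 / w) ^ p * (1 + \<epsilon> / 2) ^ (p - 1) * (1 + \<epsilon> / 2)"
        by (simp only: mult.assoc)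
      moreover have "(4 + 2 * \<epsilon>) * D = 4 * D * (1 + \<epsilon> / 2)"
        by (simp add: algebra_simps)
      moreover have "1 + \<epsilon> / 2 \<noteq> 0" using assms by simp
      ultimately show ?thesis by (simp only: mult_divide_mult_cancel_right) simp
    qed
    finally have "exp 1 * ((exp (1/2) + 2 * exp (1 + w)) / (1 + w)) ^ p
        \<le> ((2 + \<epsilon>) / w) ^ p / ((4 + 2 * \<epsilon>) * D)" .
    moreover have "EE_M p (stability_region p)
        \<le> ereal (exp 1 * ((exp (1/2) + 2 * exp (1 + w)) / (1 + w)) ^ p)"
      using p(1) w by (intro EE_M_le) auto
    ultimately have "EE_M p (stability_region p) \<le> ereal (((2 + \<epsilon>) / w) ^ p / ((4 + 2 * \<epsilon>) * D))"
      by (meson ereal_less_eq(3) order.trans)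
    then show "EE_M p (stability_region p)
        \<le> ereal (((2 + \<epsilon>) / w) ^ p / ((4 + 2 * \<epsilon>) * pi * sqrt (real p - 1)))"
      by (simp only: D_def mult.assoc)
  next
    have "1 / w < 3.595" using w_gt w by (simp add: field_simps)
    then have "(2 + \<epsilon>) * (1 / w) < (2 + \<epsilon>) * 3.595"
      using assms by (intro mult_strict_left_mono) auto
    then have "(2 + \<epsilon>) / w < (2 + \<epsilon>) * 3.595" by simp
    also have "\<dots> \<le> 7.19 + 3.6 * \<epsilon>" using assms by (simp add: algebra_simps)
    finally have "((2 + \<epsilon>) / w) ^ p < (7.19 + 3.6 * \<epsilon>) ^ p"
      using p(1) w assms by (intro power_strict_mono) auto
    then show "((2 + \<epsilon>) / w) ^ p / ((4 + 2 * \<epsilon>) * pi * sqrt (real p - 1))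
        < (7.19 + 3.6 * \<epsilon>) ^ p / ((4 + 2 * \<epsilon>) * pi * sqrt (real p - 1))"
      using p(1) assms by (intro divide_strict_right_mono) auto
  qed
  then show ?thesis
    unfolding w_def by (intro exI[of _ "Suc N"]) auto
qed

end
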